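(* Let $R=\mathcal{R}(d(t),t)$ with $d(t)=d_0+d_1t+d_2t^2+\cdots$, $d_0\neq0$. Then for every integer $m\ge0$, $$\mathrm{Der}^{2m}(R)=\mathcal{R}\Big(\sum_{i=0}^m S_{m+1,i+1}\,t^i d^{(i)}(t),\;t\Big)=\mathcal{R}\Big(\sum_{i\ge0}d_i(i+1)^mt^i,\;t\Big),$$ $$\mathrm{Der}^{2m+1}(R)=\mathcal{R}\Big(1,\;\sum_{i=0}^m S_{m+1,i+1}\,t^{i+1}d^{(i)}(t)\Big)=\mathcal{R}\Big(1,\;t\sum_{i\ge0}d_i(i+1)^mt^i\Big),$$ where $S_{m+1,i+1}$ is a Stirling number of the second kind and $d^{(i)}(t)$ is the $i$th derivative of $d(t)$.
   Context: For formal power series $d(t),h(t)$ with $d(0)\neq0$, $h(0)=0$, $h'(0)\neq0$, $\mathcal{R}(d(t),h(t))$ is the infinite lower triangular matrix with $(n,k)$-entry $[t^n]\,d(t)h(t)^k$ ($n,k\ge0$). The operation $\mathrm{Der}$ is $\mathrm{Der}(\mathcal{R}(d(t),h(t)))=\mathcal{R}(h'(t),t\,d(t))$, and $\mathrm{Der}^k$ denotes $\mathrm{Der}$ iterated $k$ times ($\mathrm{Der}^0$ is the identity). *)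

theory Defs
  imports "HOL-Computational_Algebra.Formal_Power_Series" "HOL-Combinatorics.Stirling"
begin

type_synonym 'a inf_matrix = "nat \<Rightarrow> nat \<Rightarrow> 'a"

definition riordan :: "'a::field fps \<Rightarrow> 'a fps \<Rightarrow> 'a inf_matrix" where
  "riordan d h = (\<lambda>n k. fps_nth (d * h ^ k) n)"

definition riordan_pair :: "'a::field fps \<Rightarrow> 'a fps \<Rightarrow> bool" where
  "riordan_pair d h \<longleftrightarrow>
     fps_nth d 0 \<noteq> 0 \<and> fps_nth h 0 = 0 \<and> fps_nth (fps_deriv h) 0 \<noteq> 0"

(* Der acts on the matrix, not on the pair of series; it is well defined because a
   Riordan array determines its pair (riordan_inject), and then satisfies the defining
   equation Der_riordan.  On matrices that are not Riordan arrays it is unspecified. *)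
definition Der :: "'a::field inf_matrix \<Rightarrow> 'a inf_matrix" where
  "Der M = (THE N. \<exists>d h. riordan_pair d h \<and> M = riordan d h \<and>
                         N = riordan (fps_deriv h) (fps_X * d))"

lemma riordan_inject:
  fixes d h d' h' :: "'a::field fps"
  assumes "riordan_pair d h" "riordan d h = riordan d' h'"
  shows "d = d'" "h = h'"
proof -
  have col: "d * h ^ k = d' * h' ^ k" for k
    using assms(2) by (intro fps_ext) (simp add: riordan_def fun_eq_iff)
  show d: "d = d'"
    using col[of 0] by simp
  have "d \<noteq> 0"
    using assms(1) by (auto simp: riordan_pair_def)
  then show "h = h'"
    using col[of 1] d by simp
qed

lemma Der_riordan:
  fixes d h :: "'a::field fps"
  assumes "riordan_pair d h"
  shows "Der (riordan d h) = riordan (fps_deriv h) (fps_X * d)"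
  unfolding Der_def
  by (rule the_equality) (use assms riordan_inject in blast)+

lemma riordan_pair_Der:
  fixes d h :: "'a::field fps"
  assumes "riordan_pair d h"
  shows "riordan_pair (fps_deriv h) (fps_X * d)"
  using assms by (simp add: riordan_pair_def)

end

theory Submission
  imports Defs
begin

text \<open>
  Two applications of \<open>Der\<close> send \<open>\<R>(d, t)\<close> to \<open>\<R>((t d)', t)\<close>. So everything
  reduces to iterating the operator \<open>f \<mapsto> (t f)'\<close>, which multiplies the coefficient of \<open>t\<^sup>n\<close>
  by \<open>n + 1\<close>. On \<open>t\<^sup>i d\<^sup>(\<^sup>i\<^sup>)\<close> it gives \<open>(i + 1) t\<^sup>i d\<^sup>(\<^sup>i\<^sup>) + t\<^sup>i\<^sup>+\<^sup>1 d\<^sup>(\<^sup>i\<^sup>+\<^sup>1\<^sup>)\<close>,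
  which is the recurrence of the Stirling numbers of the second kind.
\<close>

definition fps_deriv_X_mult :: "'a::comm_semiring_1 fps \<Rightarrow> 'a fps" where
  "fps_deriv_X_mult f = fps_deriv (fps_X * f)"

lemma fps_deriv_X_mult_nth:
  "fps_nth (fps_deriv_X_mult f) n = of_nat (n + 1) * fps_nth f n"
  by (simp add: fps_deriv_X_mult_def del: fps_deriv_mult)

lemma fps_deriv_X_mult_of_nat_mult:
  "fps_deriv_X_mult (of_nat k * f) = of_nat k * fps_deriv_X_mult f"
  by (simp add: fps_deriv_X_mult_def algebra_simps)

lemma fps_deriv_X_mult_sum:
  "fps_deriv_X_mult (sum f A) = (\<Sum>i\<in>A. fps_deriv_X_mult (f i))"
  by (simp add: fps_deriv_X_mult_def sum_distrib_left fps_deriv_sum del: fps_deriv_mult)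

text \<open>At \<open>n = 0\<close> the factor is 1, so iteration fixes the constant term, in any
  characteristic. For general \<open>n\<close> this supplies the closed form of the
  coefficients.\<close>

lemma funpow_fps_deriv_X_mult_nth:
  fixes d :: "'a::comm_semiring_1 fps"
  shows "fps_nth ((fps_deriv_X_mult ^^ m) d) n = fps_nth d n * of_nat (n + 1) ^ m"
  by (induction m) (simp_all add: fps_deriv_X_mult_nth mult_ac)

lemma fps_deriv_X_mult_X_power_mult:
  fixes f :: "'a::comm_semiring_1 fps"
  shows "fps_deriv_X_mult (fps_X ^ i * f) =
           of_nat (i + 1) * (fps_X ^ i * f) + fps_X ^ (i + 1) * fps_deriv f"
proof -
  \<comment> \<open>The factor \<open>fps_X\<close> is absorbed into the power first, so that one
    product rule yields the coefficient \<open>i + 1\<close>.\<close>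
  have "fps_deriv_X_mult (fps_X ^ i * f) = fps_deriv (fps_X ^ (i + 1) * f)"
    by (simp only: fps_deriv_X_mult_def power_add power_one_right mult_ac)
  also have "\<dots> = of_nat (i + 1) * (fps_X ^ i * f) + fps_X ^ (i + 1) * fps_deriv f"
    by (simp only: fps_deriv_mult fps_deriv_power') (simp add: algebra_simps)
  finally show ?thesis .
qed

text \<open>Rests on S(m+2, i+1) = (i+1) S(m+1, i+1) + S(m+1, i). An arbitrary \<open>f\<close>
  keeps this bookkeeping apart from the calculus.\<close>

lemma sum_Stirling_Suc:
  fixes f :: "nat \<Rightarrow> 'a::comm_semiring_1"
  shows "(\<Sum>i=0..Suc m. of_nat (Stirling (Suc m + 1) (i + 1)) * f i) =
         (\<Sum>i=0..m. of_nat (Stirling (m + 1) (i + 1)) * (of_nat (i + 1) * f i + f (i + 1)))"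
proof -
  have "(\<Sum>i=0..Suc m. of_nat (Stirling (Suc m + 1) (i + 1)) * f i) =
        (\<Sum>i=0..Suc m. of_nat (Stirling (m + 1) (i + 1)) * (of_nat (i + 1) * f i)) +
        (\<Sum>i=0..Suc m. of_nat (Stirling (m + 1) i) * f i)"
    by (simp add: sum.distrib[symmetric] algebra_simps del: sum.atLeast0_atMost_Suc)
  \<comment> \<open>The top term drops because S(m+1, m+2) = 0.\<close>
  also have "(\<Sum>i=0..Suc m. of_nat (Stirling (m + 1) (i + 1)) * (of_nat (i + 1) * f i)) =
             (\<Sum>i=0..m. of_nat (Stirling (m + 1) (i + 1)) * (of_nat (i + 1) * f i))"
    by (simp del: Stirling.simps)
  \<comment> \<open>The term \<open>i = 0\<close> drops because S(m+1, 0) = 0; the rest is shifted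
    by one.\<close>
  also have "(\<Sum>i=0..Suc m. of_nat (Stirling (m + 1) i) * f i) =
             (\<Sum>i=0..m. of_nat (Stirling (m + 1) (i + 1)) * f (i + 1))"
    by (subst sum.atLeast0_atMost_Suc_shift) simp
  finally show ?thesis
    by (simp add: sum.distrib distrib_left del: Stirling.simps)
qed

lemma sum_Stirling_fps_deriv:
  fixes d :: "'a::comm_semiring_1 fps"
  shows "(\<Sum>i=0..m. of_nat (Stirling (m + 1) (i + 1)) * (fps_X ^ i * (fps_deriv ^^ i) d)) =
         (fps_deriv_X_mult ^^ m) d"
proof (induction m)
  case 0
  show ?case by simp
next
  case (Suc m)
  have "(fps_deriv_X_mult ^^ Suc m) d =
        (\<Sum>i=0..m. fps_deriv_X_mult
           (of_nat (Stirling (m + 1) (i + 1)) * (fps_X ^ i * (fps_deriv ^^ i) d)))"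
    by (simp add: Suc.IH[symmetric] fps_deriv_X_mult_sum del: Stirling.simps)
  also have "\<dots> = (\<Sum>i=0..m. of_nat (Stirling (m + 1) (i + 1)) *
           fps_deriv_X_mult (fps_X ^ i * (fps_deriv ^^ i) d))"
    by (simp only: fps_deriv_X_mult_of_nat_mult)
  also have "\<dots> = (\<Sum>i=0..m. of_nat (Stirling (m + 1) (i + 1)) *
           (of_nat (i + 1) * (fps_X ^ i * (fps_deriv ^^ i) d) +
             fps_X ^ (i + 1) * (fps_deriv ^^ (i + 1)) d))"
    by (simp only: fps_deriv_X_mult_X_power_mult) simp
  \<comment> \<open>With \<open>f i = fps_X ^ i * (fps_deriv ^^ i) d\<close>, the bracket above is
    \<open>of_nat (i + 1) * f i + f (i + 1)\<close>.\<close>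
  also have "\<dots> = (\<Sum>i=0..Suc m. of_nat (Stirling (Suc m + 1) (i + 1)) *
           (fps_X ^ i * (fps_deriv ^^ i) d))"
    by (rule sum_Stirling_Suc[symmetric])
  finally show ?case ..
qed

lemma Der_riordan_X:
  fixes d :: "'a::field fps"
  assumes "fps_nth d 0 \<noteq> 0"
  shows "Der (riordan d fps_X) = riordan 1 (fps_X * d)"
  using assms by (simp add: Der_riordan riordan_pair_def)

lemma Der_even_power_riordan_X:
  fixes d :: "'a::field fps"
  assumes "fps_nth d 0 \<noteq> 0"
  shows "(Der ^^ (2 * m)) (riordan d fps_X) =
           riordan ((fps_deriv_X_mult ^^ m) d) fps_X"
proof (induction m)
  case 0
  show ?case by simp
next
  case (Suc m)
  let ?f = "(fps_deriv_X_mult ^^ m) d"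
  \<comment> \<open>This makes both \<open>(?f, fps_X)\<close> and \<open>(1, fps_X * ?f)\<close>
    Riordan pairs, as the two applications of \<open>Der\<close> require.\<close>
  have f0: "fps_nth ?f 0 \<noteq> 0"
    using assms by (simp add: funpow_fps_deriv_X_mult_nth)
  have "(Der ^^ (2 * Suc m)) (riordan d fps_X) = Der (Der (riordan ?f fps_X))"
    by (simp add: Suc.IH)
  also have "\<dots> = Der (riordan 1 (fps_X * ?f))"
    using f0 by (simp add: Der_riordan_X)
  also have "\<dots> = riordan (fps_deriv (fps_X * ?f)) (fps_X * 1)"
    using f0 by (intro Der_riordan) (simp add: riordan_pair_def)
  \<comment> \<open>Instantiating at \<open>?f\<close> unfolds only the outermost application; the
    inner iterate stays folded.\<close>
  finally show ?case by (simp add: fps_deriv_X_mult_def[of ?f])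
qed

theorem theorem4p8:
  fixes d :: "'a::field fps" and m :: nat
  assumes "fps_nth d 0 \<noteq> 0"
  shows "(Der ^^ (2 * m)) (riordan d fps_X) =
           riordan (\<Sum>i=0..m. of_nat (Stirling (m + 1) (i + 1)) * fps_X ^ i * (fps_deriv ^^ i) d) fps_X
    \<and> riordan (\<Sum>i=0..m. of_nat (Stirling (m + 1) (i + 1)) * fps_X ^ i * (fps_deriv ^^ i) d) fps_X =
           riordan (Abs_fps (\<lambda>i. fps_nth d i * of_nat (i + 1) ^ m)) fps_X
    \<and> (Der ^^ (2 * m + 1)) (riordan d fps_X) =
           riordan 1 (\<Sum>i=0..m. of_nat (Stirling (m + 1) (i + 1)) * fps_X ^ (i + 1) * (fps_deriv ^^ i) d)
    \<and> riordan 1 (\<Sum>i=0..m. of_nat (Stirling (m + 1) (i + 1)) * fps_X ^ (i + 1) * (fps_deriv ^^ i) d) =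
           riordan 1 (fps_X * Abs_fps (\<lambda>i. fps_nth d i * of_nat (i + 1) ^ m))"
proof -
  let ?f = "(fps_deriv_X_mult ^^ m) d"
  have even_sum: "(\<Sum>i=0..m. of_nat (Stirling (m + 1) (i + 1)) * fps_X ^ i * (fps_deriv ^^ i) d) = ?f"
    by (simp add: sum_Stirling_fps_deriv[symmetric] mult.assoc del: Stirling.simps)
  have odd_sum: "(\<Sum>i=0..m. of_nat (Stirling (m + 1) (i + 1)) * fps_X ^ (i + 1) * (fps_deriv ^^ i) d) =
      fps_X * ?f"
    by (simp add: even_sum[symmetric] sum_distrib_left mult_ac del: Stirling.simps)
  have coeffs: "Abs_fps (\<lambda>i. fps_nth d i * of_nat (i + 1) ^ m) = ?f"
    by (rule fps_ext) (simp add: funpow_fps_deriv_X_mult_nth)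
  \<comment> \<open>The even power ends at \<open>riordan ?f fps_X\<close>; a nonzero constant term
    permits the one further \<open>Der\<close> of the odd case.\<close>
  have "fps_nth ?f 0 \<noteq> 0"
    using assms by (simp add: funpow_fps_deriv_X_mult_nth)
  then have "(Der ^^ (2 * m + 1)) (riordan d fps_X) = riordan 1 (fps_X * ?f)"
    using assms by (simp add: Der_even_power_riordan_X Der_riordan_X)
  then show ?thesis
    unfolding even_sum odd_sum coeffs using Der_even_power_riordan_X[OF assms] by simp
qed

end
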